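(* Let ${\bf X}^{(k)}=(X_1^{(k)},\ldots,X_n^{(k)})$, $k=1,\ldots,K$, be independent random vectors in $\mathbb{R}^n$ such that for each $k$ the components $X_1^{(k)},\ldots,X_n^{(k)}$ of ${\bf X}^{(k)}$ are negatively associated. Let $S_i=\sum_{k=1}^K X_i^{(k)}$, $i=1,\ldots,n$. Then $S_1,\ldots,S_n$ are negatively associated. More generally, the variables $S_i=u_i\left(X_i^{(1)},\ldots,X_i^{(K)}\right)$, $i=1,\ldots,n$, where the $u_i:\mathbb{R}^K\to\mathbb{R}$ are any (coordinate-wise) increasing functions, are negatively associated.
   Context: Throughout, increasing means nondecreasing. Random variables $S_1,\ldots,S_n$ (or the vector $(S_1,\ldots,S_n)$) are said to be negatively associated (NA) if for every pair of disjoint subsets $A_1, A_2$ of $\{1,\ldots,n\}$, $$\mathrm{Cov}\left(f_1(S_i, i\in A_1),\, f_2(S_j, j\in A_2)\right)\leq 0$$ whenever $f_1$ and $f_2$ are real-valued functions, increasing in all coordinates, for which the covariance exists. The vectors ${\bf X}^{(k)}$ are independent of one another; components within one vector need not be independent. (Interpretation: $X_i^{(k)}$ is the random payoff to player $i$ in round $k$ of a sequence of $K$ $n$-player games.) *)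

theory Defs
  imports "HOL-Probability.Probability"
begin

definition has_covariance :: "'a measure \<Rightarrow> ('a \<Rightarrow> real) \<Rightarrow> ('a \<Rightarrow> real) \<Rightarrow> bool" where
  "has_covariance M Y Z \<longleftrightarrow>
     integrable M Y \<and> integrable M Z \<and> integrable M (\<lambda>\<omega>. Y \<omega> * Z \<omega>)"

definition covariance :: "'a measure \<Rightarrow> ('a \<Rightarrow> real) \<Rightarrow> ('a \<Rightarrow> real) \<Rightarrow> real" where
  "covariance M Y Z =
     (\<integral>\<omega>. (Y \<omega> - (\<integral>\<omega>'. Y \<omega>' \<partial>M)) * (Z \<omega> - (\<integral>\<omega>'. Z \<omega>' \<partial>M)) \<partial>M)"

(* \<real>^J, for an index set J, is rendered as the set J \<rightarrow>\<^sub>E UNIV of extensional functions;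
   on it the pointwise order of functions is the coordinatewise order, since all
   its elements take the same value outside J. *)
definition coord_increasing :: "'i set \<Rightarrow> (('i \<Rightarrow> real) \<Rightarrow> real) \<Rightarrow> bool" where
  "coord_increasing J f \<longleftrightarrow> mono_on (J \<rightarrow>\<^sub>E UNIV) f"

(* An increasing function of two or more variables need not be Borel, and then f(S) need
   not be a random variable; "the covariance exists" therefore includes that the test
   functions are Borel. *)
definition neg_assoc :: "'a measure \<Rightarrow> 'i set \<Rightarrow> ('i \<Rightarrow> 'a \<Rightarrow> real) \<Rightarrow> bool" where
  "neg_assoc M I S \<longleftrightarrow>
     (\<forall>i\<in>I. S i \<in> borel_measurable M) \<and>
     (\<forall>A1 A2 f1 f2.
        A1 \<subseteq> I \<and> A2 \<subseteq> I \<and> A1 \<inter> A2 = {} \<and>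
        coord_increasing A1 f1 \<and> f1 \<in> borel_measurable (PiM A1 (\<lambda>_. borel)) \<and>
        coord_increasing A2 f2 \<and> f2 \<in> borel_measurable (PiM A2 (\<lambda>_. borel)) \<and>
        has_covariance M (\<lambda>\<omega>. f1 (\<lambda>i\<in>A1. S i \<omega>)) (\<lambda>\<omega>. f2 (\<lambda>j\<in>A2. S j \<omega>)) \<longrightarrow>
        covariance M (\<lambda>\<omega>. f1 (\<lambda>i\<in>A1. S i \<omega>)) (\<lambda>\<omega>. f2 (\<lambda>j\<in>A2. S j \<omega>)) \<le> 0)"

end

theory Submission
  imports Defs
begin

text \<open>
  Suppose first that the functions \<open>u\<^sub>i\<close> are Borel. An increasing function \<open>f\<^sub>1\<close> of the
  \<open>S\<^sub>i\<close> with \<open>i \<in> A\<^sub>1\<close> is then a Borel function \<open>F\<^sub>1\<close> of the whole array of the \<open>X\<^sub>i\<^sup>(\<^sup>k\<^sup>)\<close>,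
  increasing in the entries with \<open>i \<in> A\<^sub>1\<close> and constant in the others; likewise \<open>f\<^sub>2\<close> and
  \<open>A\<^sub>2\<close> give \<open>F\<^sub>2\<close>. The inequality \<open>E (F\<^sub>1 F\<^sub>2) \<le> E F\<^sub>1 E F\<^sub>2\<close> for such functions passes from the
  single vectors to the product of their laws by induction on the number of vectors
  (\<open>neg_assoc_PiM\<close>): for fixed values of the other vectors, negative association of one vector
  bounds its integral of \<open>F\<^sub>1 F\<^sub>2\<close> by the product of its integrals of \<open>F\<^sub>1\<close> and \<open>F\<^sub>2\<close>, and these
  partial integrals are again increasing in the entries of the remaining vectors with
  \<open>i \<in> A\<^sub>1\<close> and \<open>i \<in> A\<^sub>2\<close> respectively. Partial integrals of unbounded functions
  need not converge, so the induction runs with bounded functions, and the general case follows by truncation and dominated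
  convergence (\<open>covariance_nonpos_truncation\<close>).

  An increasing function of several variables need not be Borel, and measurability of the
  composition \<open>u\<^sub>i (X\<^sub>i)\<close> on the probability space does not make it so. But the arguments
  \<open>X\<^sub>i\<^sup>(\<^sup>1\<^sup>), \<dots>, X\<^sub>i\<^sup>(\<^sup>K\<^sup>)\<close> of \<open>u\<^sub>i\<close> are independent, and with respect to any product of
  probability measures on the line an increasing function lies between two Borel increasing
  functions that agree almost everywhere (\<open>increasing_between_Borel\<close>). Hence each \<open>u\<^sub>i\<close> may be
  replaced by a Borel increasing function that changes \<open>S\<^sub>i\<close> only on a null set, and negative
  association ignores null sets (\<open>neg_assoc_cong_AE\<close>).
\<close>

section \<open>Covariance and truncation\<close>

lemma (in prob_space) covariance_eq:
  assumes "has_covariance M Y Z"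
  shows "covariance M Y Z = expectation (\<lambda>\<omega>. Y \<omega> * Z \<omega>) - expectation Y * expectation Z"
proof -
  have [simp]: "integrable M Y" "integrable M Z" "integrable M (\<lambda>\<omega>. Y \<omega> * Z \<omega>)"
    using assms by (auto simp: has_covariance_def)
  have "covariance M Y Z = expectation (\<lambda>\<omega>. Y \<omega> * Z \<omega> - expectation Z * Y \<omega>
      - expectation Y * Z \<omega> + expectation Y * expectation Z)"
    unfolding covariance_def by (intro Bochner_Integration.integral_cong) (auto simp: algebra_simps)
  also have "\<dots> = expectation (\<lambda>\<omega>. Y \<omega> * Z \<omega>) - expectation Y * expectation Z"
    by (simp add: prob_space)
  finally show ?thesis .
qed

lemma (in prob_space) has_covariance_bounded:
  assumes [measurable]: "Y \<in> borel_measurable M" "Z \<in> borel_measurable M"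
    and "\<And>\<omega>. \<bar>Y \<omega>\<bar> \<le> c" "\<And>\<omega>. \<bar>Z \<omega>\<bar> \<le> c"
  shows "has_covariance M Y Z"
proof -
  have "\<bar>Y \<omega> * Z \<omega>\<bar> \<le> c * c" for \<omega>
    unfolding abs_mult using assms(3,4)[of \<omega>] by (intro mult_mono) auto
  then show ?thesis
    unfolding has_covariance_def
    by (intro conjI integrable_const_bound[where B=c] integrable_const_bound[where B="c * c"])
      (use assms(3,4) in auto)
qed

definition trunc :: "nat \<Rightarrow> real \<Rightarrow> real" where
  "trunc m y = max (- real m) (min (real m) y)"

lemma trunc_mono: "x \<le> y \<Longrightarrow> trunc m x \<le> trunc m y"
  by (auto simp: trunc_def)

lemma abs_trunc_le: "\<bar>trunc m y\<bar> \<le> real m" "\<bar>trunc m y\<bar> \<le> \<bar>y\<bar>"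
  by (auto simp: trunc_def)

lemma measurable_trunc [measurable]: "trunc m \<in> borel_measurable borel"
  unfolding trunc_def by measurable

lemma trunc_tendsto: "(\<lambda>m. trunc m y) \<longlonglongrightarrow> y"
proof (rule tendsto_eventually)
  obtain N :: nat where N: "\<bar>y\<bar> \<le> real N" using real_arch_simple by blast
  show "\<forall>\<^sub>F m in sequentially. trunc m y = y"
    using eventually_ge_at_top[of N] by eventually_elim (use N in \<open>auto simp: trunc_def\<close>)
qed

text \<open>
  Since \<open>\<bar>trunc m y\<bar> \<le> \<bar>y\<bar>\<close>, the three integrands are dominated by \<open>\<bar>Y\<bar>\<close>, \<open>\<bar>Z\<bar>\<close> and
  \<open>\<bar>Y Z\<bar>\<close>, which are integrable because the covariance exists. Clipping is increasing, so it
  turns increasing test functions into bounded increasing ones.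
\<close>

lemma (in prob_space) covariance_nonpos_truncation:
  assumes hc: "has_covariance M Y Z"
    and le: "\<And>m. expectation (\<lambda>\<omega>. trunc m (Y \<omega>) * trunc m (Z \<omega>))
      \<le> expectation (\<lambda>\<omega>. trunc m (Y \<omega>)) * expectation (\<lambda>\<omega>. trunc m (Z \<omega>))"
  shows "covariance M Y Z \<le> 0"
proof -
  have i: "integrable M Y" "integrable M Z" "integrable M (\<lambda>\<omega>. Y \<omega> * Z \<omega>)"
    using hc by (auto simp: has_covariance_def)
  then have [measurable]: "Y \<in> borel_measurable M" "Z \<in> borel_measurable M" by auto
  have lim: "(\<lambda>m. expectation (\<lambda>\<omega>. trunc m (W \<omega>))) \<longlonglongrightarrow> expectation W"
    if "integrable M W" for W
    using that by (intro integral_dominated_convergence[where w="\<lambda>\<omega>. \<bar>W \<omega>\<bar>"])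
      (auto intro!: AE_I2 trunc_tendsto simp: abs_trunc_le)
  have "(\<lambda>m. expectation (\<lambda>\<omega>. trunc m (Y \<omega>) * trunc m (Z \<omega>)))
      \<longlonglongrightarrow> expectation (\<lambda>\<omega>. Y \<omega> * Z \<omega>)"
  proof (rule integral_dominated_convergence[where w="\<lambda>\<omega>. \<bar>Y \<omega> * Z \<omega>\<bar>"])
    show "integrable M (\<lambda>\<omega>. \<bar>Y \<omega> * Z \<omega>\<bar>)" using i(3) by (rule integrable_abs)
  qed (auto intro!: AE_I2 tendsto_mult trunc_tendsto mult_mono simp: abs_trunc_le abs_mult)
  moreover have "(\<lambda>m. expectation (\<lambda>\<omega>. trunc m (Y \<omega>)) * expectation (\<lambda>\<omega>. trunc m (Z \<omega>)))
      \<longlonglongrightarrow> expectation Y * expectation Z"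
    by (intro tendsto_mult lim i)
  ultimately have "expectation (\<lambda>\<omega>. Y \<omega> * Z \<omega>) \<le> expectation Y * expectation Z"
    by (rule LIMSEQ_le) (use le in auto)
  then show ?thesis by (simp add: covariance_eq[OF hc])
qed

text \<open>
  Measurability of the \<open>T\<^sub>i\<close> is assumed because the space need not be complete: changing a
  variable on a null set could destroy it.
\<close>

lemma (in prob_space) neg_assoc_cong_AE:
  assumes "finite I" and na: "neg_assoc M I S"
    and T: "\<And>i. i \<in> I \<Longrightarrow> T i \<in> borel_measurable M"
    and eq: "\<And>i. i \<in> I \<Longrightarrow> AE \<omega> in M. T i \<omega> = S i \<omega>"
  shows "neg_assoc M I T"
  unfolding neg_assoc_def
proof (intro conjI ballI allI impI; (elim conjE)?)
  fix A1 A2 and f1 f2 :: "('b \<Rightarrow> real) \<Rightarrow> real"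
  assume A: "A1 \<subseteq> I" "A2 \<subseteq> I" "A1 \<inter> A2 = {}"
    and f1: "coord_increasing A1 f1" "f1 \<in> borel_measurable (PiM A1 (\<lambda>_. borel))"
    and f2: "coord_increasing A2 f2" "f2 \<in> borel_measurable (PiM A2 (\<lambda>_. borel))"
    and hc: "has_covariance M (\<lambda>\<omega>. f1 (\<lambda>i\<in>A1. T i \<omega>)) (\<lambda>\<omega>. f2 (\<lambda>j\<in>A2. T j \<omega>))"
  have S: "S i \<in> borel_measurable M" if "i \<in> I" for i
    using na that by (auto simp: neg_assoc_def)
  have meas: "(\<lambda>\<omega>. f (\<lambda>i\<in>A. R i \<omega>)) \<in> borel_measurable M"
    if "A \<subseteq> I" "\<And>i. i \<in> I \<Longrightarrow> R i \<in> borel_measurable M" "f \<in> borel_measurable (PiM A (\<lambda>_. borel))"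
    for A R and f :: "('b \<Rightarrow> real) \<Rightarrow> real"
    by (rule measurable_compose[OF measurable_restrict that(3)]) (use that in auto)
  have "AE \<omega> in M. \<forall>i\<in>I. T i \<omega> = S i \<omega>" using \<open>finite I\<close> eq by (simp add: AE_finite_all)
  then have ae: "AE \<omega> in M. f (\<lambda>i\<in>A. T i \<omega>) = f (\<lambda>i\<in>A. S i \<omega>)"
    if "A \<subseteq> I" for A and f :: "('b \<Rightarrow> real) \<Rightarrow> real"
    by eventually_elim (use that in \<open>auto intro!: arg_cong[where f=f] restrict_ext\<close>)
  note [measurable] = meas[OF A(1) T f1(2)] meas[OF A(2) T f2(2)]
    meas[OF A(1) S f1(2)] meas[OF A(2) S f2(2)]
  note e1 = ae[OF A(1), of f1] and e2 = ae[OF A(2), of f2]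
  have e12: "AE \<omega> in M. f1 (\<lambda>i\<in>A1. T i \<omega>) * f2 (\<lambda>j\<in>A2. T j \<omega>)
      = f1 (\<lambda>i\<in>A1. S i \<omega>) * f2 (\<lambda>j\<in>A2. S j \<omega>)"
    using e1 e2 by eventually_elim simp
  have hcS: "has_covariance M (\<lambda>\<omega>. f1 (\<lambda>i\<in>A1. S i \<omega>)) (\<lambda>\<omega>. f2 (\<lambda>j\<in>A2. S j \<omega>))"
    using hc integrable_cong_AE[OF _ _ e1] integrable_cong_AE[OF _ _ e2] integrable_cong_AE[OF _ _ e12]
    by (simp add: has_covariance_def)
  then have "covariance M (\<lambda>\<omega>. f1 (\<lambda>i\<in>A1. S i \<omega>)) (\<lambda>\<omega>. f2 (\<lambda>j\<in>A2. S j \<omega>)) \<le> 0"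
    using na A f1 f2 unfolding neg_assoc_def by blast
  then show "covariance M (\<lambda>\<omega>. f1 (\<lambda>i\<in>A1. T i \<omega>)) (\<lambda>\<omega>. f2 (\<lambda>j\<in>A2. T j \<omega>)) \<le> 0"
    unfolding covariance_eq[OF hc] covariance_eq[OF hcS]
    using integral_cong_AE[OF _ _ e1] integral_cong_AE[OF _ _ e2] integral_cong_AE[OF _ _ e12] by simp
qed (use T in auto)

section \<open>Negative association as a property of a law\<close>

text \<open>
  Comparing only the coordinates in \<open>A\<close> says two things at once: \<open>g\<close> depends on no other
  coordinate (compare \<open>x\<close> and \<open>y\<close> that agree on \<open>A\<close> in both directions), and it increases in
  those of \<open>A\<close>. All test functions thus live on the same space, which keeps restrictions to
  \<open>A\<^sub>1\<close> and \<open>A\<^sub>2\<close> out of the integrals.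
\<close>

definition increasing_along :: "'i set \<Rightarrow> 'i set \<Rightarrow> (('i \<Rightarrow> real) \<Rightarrow> real) \<Rightarrow> bool" where
  "increasing_along I A g \<longleftrightarrow>
    (\<forall>x\<in>I \<rightarrow>\<^sub>E UNIV. \<forall>y\<in>I \<rightarrow>\<^sub>E UNIV. (\<forall>i\<in>A. x i \<le> y i) \<longrightarrow> g x \<le> g y)"

definition neg_assoc_law :: "'i set \<Rightarrow> ('i \<Rightarrow> real) measure \<Rightarrow> bool" where
  "neg_assoc_law I N \<longleftrightarrow> (\<forall>A1 A2 g1 g2 c.
     A1 \<subseteq> I \<and> A2 \<subseteq> I \<and> A1 \<inter> A2 = {} \<and>
     increasing_along I A1 g1 \<and> g1 \<in> borel_measurable (PiM I (\<lambda>_. borel)) \<and>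
     increasing_along I A2 g2 \<and> g2 \<in> borel_measurable (PiM I (\<lambda>_. borel)) \<and>
     (\<forall>x. \<bar>g1 x\<bar> \<le> c) \<and> (\<forall>x. \<bar>g2 x\<bar> \<le> c) \<longrightarrow>
     (\<integral>x. g1 x * g2 x \<partial>N) \<le> (\<integral>x. g1 x \<partial>N) * (\<integral>x. g2 x \<partial>N))"

lemma neg_assoc_lawD:
  assumes "neg_assoc_law I N" and "A1 \<subseteq> I" "A2 \<subseteq> I" "A1 \<inter> A2 = {}"
    and "increasing_along I A1 g1" "g1 \<in> borel_measurable (PiM I (\<lambda>_. borel))"
    and "increasing_along I A2 g2" "g2 \<in> borel_measurable (PiM I (\<lambda>_. borel))"
    and "\<And>x. \<bar>g1 x\<bar> \<le> c" "\<And>x. \<bar>g2 x\<bar> \<le> c"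
  shows "(\<integral>x. g1 x * g2 x \<partial>N) \<le> (\<integral>x. g1 x \<partial>N) * (\<integral>x. g2 x \<partial>N)"
  using assms(1)[unfolded neg_assoc_law_def, THEN spec[of _ A1], THEN spec[of _ A2],
    THEN spec[of _ g1], THEN spec[of _ g2], THEN spec[of _ c]] assms(2-) by simp

text \<open>
  A function on \<open>\<real>\<^sup>I\<close> that is increasing along \<open>A\<close> becomes a test function on \<open>\<real>\<^sup>A\<close> after
  its argument is filled up with zeros.
\<close>

lemma (in prob_space) neg_assoc_imp_law:
  assumes na: "neg_assoc M I X"
  shows "neg_assoc_law I (distr M (PiM I (\<lambda>_. borel)) (\<lambda>\<omega>. \<lambda>i\<in>I. X i \<omega>))"
  unfolding neg_assoc_law_def
proof (intro allI impI, elim conjE)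
  fix A1 A2 and g1 g2 :: "('b \<Rightarrow> real) \<Rightarrow> real" and c
  assume A: "A1 \<subseteq> I" "A2 \<subseteq> I" "A1 \<inter> A2 = {}"
    and g1: "increasing_along I A1 g1" "g1 \<in> borel_measurable (PiM I (\<lambda>_. borel))"
    and g2: "increasing_along I A2 g2" "g2 \<in> borel_measurable (PiM I (\<lambda>_. borel))"
    and c: "\<forall>x. \<bar>g1 x\<bar> \<le> c" "\<forall>x. \<bar>g2 x\<bar> \<le> c"
  have X [measurable]: "X i \<in> borel_measurable M" if "i \<in> I" for i
    using na that by (auto simp: neg_assoc_def)
  define ext where "ext A y = (\<lambda>i\<in>I. if i \<in> A then y i else 0)" for A and y :: "'b \<Rightarrow> real"
  have ext_meas: "ext A \<in> measurable (PiM A (\<lambda>_. borel)) (PiM I (\<lambda>_. borel))" if "A \<subseteq> I" for A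
    unfolding ext_def
  proof (rule measurable_restrict)
    fix i assume "i \<in> I"
    show "(\<lambda>y. if i \<in> A then y i else 0) \<in> borel_measurable (PiM A (\<lambda>_. borel :: real measure))"
      by (cases "i \<in> A") auto
  qed
  have ext_inc: "coord_increasing A (\<lambda>y. g (ext A y))"
    if "A \<subseteq> I" "increasing_along I A g" for A g
    unfolding coord_increasing_def
    by (rule mono_onI, rule that(2)[unfolded increasing_along_def, rule_format])
      (use that(1) in \<open>auto simp: ext_def le_fun_def\<close>)
  have ext_eq: "g (ext A (\<lambda>i\<in>A. X i \<omega>)) = g (\<lambda>i\<in>I. X i \<omega>)"
    if "A \<subseteq> I" "increasing_along I A g" for A g \<omega>
    by (rule antisym; rule that(2)[unfolded increasing_along_def, rule_format])
      (use that(1) in \<open>auto simp: ext_def\<close>)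
  have [measurable]: "(\<lambda>\<omega>. \<lambda>i\<in>I. X i \<omega>) \<in> measurable M (PiM I (\<lambda>_. borel))"
    by (rule measurable_restrict) auto
  note [measurable] = g1(2) g2(2)
  let ?Y = "\<lambda>\<omega>. g1 (\<lambda>i\<in>I. X i \<omega>)" and ?Z = "\<lambda>\<omega>. g2 (\<lambda>i\<in>I. X i \<omega>)"
  have hc: "has_covariance M ?Y ?Z"
    by (rule has_covariance_bounded[where c=c]) (use c in auto)
  have "covariance M (\<lambda>\<omega>. g1 (ext A1 (\<lambda>i\<in>A1. X i \<omega>))) (\<lambda>\<omega>. g2 (ext A2 (\<lambda>i\<in>A2. X i \<omega>))) \<le> 0"
    using na[unfolded neg_assoc_def, THEN conjunct2, rule_format,
        of A1 A2 "\<lambda>y. g1 (ext A1 y)" "\<lambda>y. g2 (ext A2 y)"]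
      A ext_inc[OF A(1) g1(1)] ext_inc[OF A(2) g2(1)]
      measurable_compose[OF ext_meas[OF A(1)] g1(2)] measurable_compose[OF ext_meas[OF A(2)] g2(2)] hc
    by (simp add: ext_eq[OF A(1) g1(1)] ext_eq[OF A(2) g2(1)])
  then have "covariance M ?Y ?Z \<le> 0"
    by (simp add: ext_eq[OF A(1) g1(1)] ext_eq[OF A(2) g2(1)])
  then show "(\<integral>x. g1 x * g2 x \<partial>distr M (PiM I (\<lambda>_. borel)) (\<lambda>\<omega>. \<lambda>i\<in>I. X i \<omega>))
    \<le> (\<integral>x. g1 x \<partial>distr M (PiM I (\<lambda>_. borel)) (\<lambda>\<omega>. \<lambda>i\<in>I. X i \<omega>)) *
      (\<integral>x. g2 x \<partial>distr M (PiM I (\<lambda>_. borel)) (\<lambda>\<omega>. \<lambda>i\<in>I. X i \<omega>))"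
    by (simp add: covariance_eq[OF hc] integral_distr)
qed

section \<open>Products of negatively associated laws\<close>

definition jointly_increasing ::
    "'k set \<Rightarrow> 'i set \<Rightarrow> 'i set \<Rightarrow> (('k \<Rightarrow> 'i \<Rightarrow> real) \<Rightarrow> real) \<Rightarrow> bool" where
  "jointly_increasing J I A F \<longleftrightarrow>
    (\<forall>x\<in>J \<rightarrow>\<^sub>E (I \<rightarrow>\<^sub>E UNIV). \<forall>y\<in>J \<rightarrow>\<^sub>E (I \<rightarrow>\<^sub>E UNIV).
      (\<forall>k\<in>J. \<forall>i\<in>A. x k i \<le> y k i) \<longrightarrow> F x \<le> F y)"

text \<open>
  The probability measures \<open>N k\<close> are given for all \<open>k\<close>, also outside \<open>J\<close>, so that Fubini's
  theorem for product measures applies at each induction step. Integrating out the new vector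
  first reduces the claim to the induction hypothesis for the partial integrals \<open>H F\<^sub>1\<close> and
  \<open>H F\<^sub>2\<close>. The bounds hold at all points and not just on the space of the product, which makes
  them pass to \<open>H F\<close> without further conditions.
\<close>

lemma neg_assoc_PiM:
  fixes N :: "'k \<Rightarrow> ('i \<Rightarrow> real) measure"
  assumes "finite J"
    and N: "\<And>k. prob_space (N k)" "\<And>k. sets (N k) = sets (PiM I (\<lambda>_. borel))"
    and na: "\<And>k. k \<in> J \<Longrightarrow> neg_assoc_law I (N k)"
    and A: "A1 \<subseteq> I" "A2 \<subseteq> I" "A1 \<inter> A2 = {}"
    and F1: "jointly_increasing J I A1 F1" "F1 \<in> borel_measurable (PiM J N)" "\<And>x. \<bar>F1 x\<bar> \<le> c"
    and F2: "jointly_increasing J I A2 F2" "F2 \<in> borel_measurable (PiM J N)" "\<And>x. \<bar>F2 x\<bar> \<le> c"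
  shows "(\<integral>x. F1 x * F2 x \<partial>PiM J N) \<le> (\<integral>x. F1 x \<partial>PiM J N) * (\<integral>x. F2 x \<partial>PiM J N)"
  using \<open>finite J\<close> na F1 F2
proof (induction J arbitrary: F1 F2)
  case empty
  then show ?case by (simp add: PiM_empty lebesgue_integral_count_space_finite)
next
  case (insert k J)
  interpret Nk: prob_space "N k" by (rule N(1))
  interpret J: prob_space "PiM J N" using N(1) by (intro prob_space_PiM) auto
  interpret kJ: prob_space "PiM (insert k J) N" using N(1) by (intro prob_space_PiM) auto
  interpret product_sigma_finite N
    using N(1) by (simp add: product_sigma_finite_def prob_space_imp_sigma_finite)
  have sp: "space (N j) = I \<rightarrow>\<^sub>E UNIV" for j
    using sets_eq_imp_space_eq[OF N(2)] by (simp add: space_PiM)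
  have spJ: "space (PiM J N) = J \<rightarrow>\<^sub>E (I \<rightarrow>\<^sub>E UNIV)" by (simp add: space_PiM sp)
  define H where "H F x = (\<integral>y. F (x(k := y)) \<partial>N k)" for F :: "('k \<Rightarrow> 'i \<Rightarrow> real) \<Rightarrow> real" and x
  have upd [measurable]: "(\<lambda>(x, y). F (x(k := y))) \<in> borel_measurable (PiM J N \<Otimes>\<^sub>M N k)"
    if "F \<in> borel_measurable (PiM (insert k J) N)" for F :: "('k \<Rightarrow> 'i \<Rightarrow> real) \<Rightarrow> real"
    using measurable_compose[OF measurable_add_dim that] by (simp add: split_def)
  have sec [measurable]: "(\<lambda>y. F (x(k := y))) \<in> borel_measurable (N k)"
    if "F \<in> borel_measurable (PiM (insert k J) N)" "x \<in> space (PiM J N)"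
    for F :: "('k \<Rightarrow> 'i \<Rightarrow> real) \<Rightarrow> real" and x
    using measurable_Pair2[OF upd[OF that(1)] that(2)] by simp
  have H_meas: "H F \<in> borel_measurable (PiM J N)"
    if "F \<in> borel_measurable (PiM (insert k J) N)" for F
    unfolding H_def using upd[OF that] by measurable
  have H_bd: "\<bar>H F x\<bar> \<le> c" if "\<And>x. \<bar>F x\<bar> \<le> c" for F x
  proof -
    have c0: "0 \<le> c" using that[of undefined] by linarith
    have "\<bar>H F x\<bar> \<le> (\<integral>y. \<bar>F (x(k := y))\<bar> \<partial>N k)"
      unfolding H_def by (rule integral_abs_bound)
    also have "\<dots> \<le> (\<integral>y. c \<partial>N k)"
      by (rule integral_mono') (use that c0 in auto)
    finally show ?thesis by (simp add: Nk.prob_space)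
  qed
  have H_inc: "jointly_increasing J I A (H F)"
    if "jointly_increasing (insert k J) I A F" "F \<in> borel_measurable (PiM (insert k J) N)"
      "\<And>x. \<bar>F x\<bar> \<le> c" "A \<subseteq> I" for F A
    unfolding jointly_increasing_def
  proof (intro ballI impI)
    fix x y :: "'k \<Rightarrow> 'i \<Rightarrow> real"
    assume x: "x \<in> J \<rightarrow>\<^sub>E (I \<rightarrow>\<^sub>E UNIV)" and y: "y \<in> J \<rightarrow>\<^sub>E (I \<rightarrow>\<^sub>E UNIV)"
      and le: "\<forall>j\<in>J. \<forall>i\<in>A. x j i \<le> y j i"
    have int: "integrable (N k) (\<lambda>z. F (x'(k := z)))" if "x' \<in> J \<rightarrow>\<^sub>E (I \<rightarrow>\<^sub>E UNIV)" for x' :: "'k \<Rightarrow> 'i \<Rightarrow> real"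
      using \<open>\<And>x. \<bar>F x\<bar> \<le> c\<close> sec[OF \<open>F \<in> _\<close>] that spJ
      by (intro Nk.integrable_const_bound[where B=c]) auto
    show "H F x \<le> H F y"
      unfolding H_def
    proof (rule integral_mono[OF int[OF x] int[OF y]])
      fix z assume "z \<in> space (N k)"
      then have "x(k := z) \<in> insert k J \<rightarrow>\<^sub>E (I \<rightarrow>\<^sub>E UNIV)" "y(k := z) \<in> insert k J \<rightarrow>\<^sub>E (I \<rightarrow>\<^sub>E UNIV)"
        using PiE_fun_upd[OF _ x] PiE_fun_upd[OF _ y] sp by auto
      then show "F (x(k := z)) \<le> F (y(k := z))"
        using le that(1) unfolding jointly_increasing_def by auto
    qed
  qed
  have inner: "(\<integral>y. F1 (x(k := y)) * F2 (x(k := y)) \<partial>N k) \<le> H F1 x * H F2 x"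
    if x: "x \<in> space (PiM J N)" for x
  proof -
    have inc: "increasing_along I A (\<lambda>y. F (x(k := y)))"
      if "jointly_increasing (insert k J) I A F" "A \<subseteq> I" for A F
      unfolding increasing_along_def
    proof (intro ballI impI)
      fix y z :: "'i \<Rightarrow> real" assume yz: "y \<in> I \<rightarrow>\<^sub>E UNIV" "z \<in> I \<rightarrow>\<^sub>E UNIV" "\<forall>i\<in>A. y i \<le> z i"
      then have "x(k := y) \<in> insert k J \<rightarrow>\<^sub>E (I \<rightarrow>\<^sub>E UNIV)" "x(k := z) \<in> insert k J \<rightarrow>\<^sub>E (I \<rightarrow>\<^sub>E UNIV)"
        using x unfolding spJ by (intro PiE_fun_upd; simp)+
      moreover have "\<forall>j\<in>insert k J. \<forall>i\<in>A. (x(k := y)) j i \<le> (x(k := z)) j i"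
        using yz(3) by auto
      ultimately show "F (x(k := y)) \<le> F (x(k := z))"
        using that(1) unfolding jointly_increasing_def by blast
    qed
    have eq: "borel_measurable (PiM I (\<lambda>_. borel)) = borel_measurable (N k)"
      by (rule measurable_cong_sets) (simp_all add: N(2))
    show ?thesis
      unfolding H_def
      by (rule neg_assoc_lawD[OF insert.prems(1)[OF insertI1] A inc[OF insert.prems(2) A(1)] _
            inc[OF insert.prems(5) A(2)] _ insert.prems(4,7)])
        (simp_all only: eq sec[OF insert.prems(3) x] sec[OF insert.prems(6) x])
  qed
  note [measurable] = insert.prems(3,6) H_meas[OF insert.prems(3)] H_meas[OF insert.prems(6)]
  have bd2: "\<bar>a * b\<bar> \<le> c * c" if "\<bar>a\<bar> \<le> c" "\<bar>b\<bar> \<le> c" for a b :: real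
    unfolding abs_mult using that by (intro mult_mono) auto
  have fub: "(\<integral>x. F x \<partial>PiM (insert k J) N) = (\<integral>x. H F x \<partial>PiM J N)"
    if "F \<in> borel_measurable (PiM (insert k J) N)" "\<And>x. \<bar>F x\<bar> \<le> b" for F b
    unfolding H_def using insert.hyps that
    by (intro product_integral_insert kJ.integrable_const_bound[where B=b]) auto
  have "(\<integral>x. F1 x * F2 x \<partial>PiM (insert k J) N) = (\<integral>x. H (\<lambda>x. F1 x * F2 x) x \<partial>PiM J N)"
    by (rule fub) (auto intro!: bd2 insert.prems)
  also have "\<dots> \<le> (\<integral>x. H F1 x * H F2 x \<partial>PiM J N)"
  proof (rule integral_mono)
    show "integrable (PiM J N) (\<lambda>x. H F1 x * H F2 x)"
      by (rule J.integrable_const_bound[where B="c * c"])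
        (auto intro!: bd2 H_bd insert.prems)
    have "\<bar>H (\<lambda>x. F1 x * F2 x) x\<bar> \<le> c * c" for x
    proof -
      have "\<bar>H (\<lambda>x. F1 x * F2 x) x\<bar> \<le> (\<integral>y. \<bar>F1 (x(k := y)) * F2 (x(k := y))\<bar> \<partial>N k)"
        unfolding H_def by (rule integral_abs_bound)
      also have "\<dots> \<le> (\<integral>y. c * c \<partial>N k)"
        by (rule integral_mono') (use bd2[OF insert.prems(4,7)] in auto)
      finally show ?thesis by (simp add: Nk.prob_space)
    qed
    then show "integrable (PiM J N) (H (\<lambda>x. F1 x * F2 x))"
      by (intro J.integrable_const_bound[where B="c * c"] H_meas) auto
  qed (use inner in \<open>simp add: H_def\<close>)
  also have "\<dots> \<le> (\<integral>x. H F1 x \<partial>PiM J N) * (\<integral>x. H F2 x \<partial>PiM J N)"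
    by (intro insert.IH H_inc H_bd H_meas insert.prems A) auto
  also have "\<dots> = (\<integral>x. F1 x \<partial>PiM (insert k J) N) * (\<integral>x. F2 x \<partial>PiM (insert k J) N)"
    using fub[OF insert.prems(3,4)] fub[OF insert.prems(6,7)] by simp
  finally show ?case .
qed

section \<open>Increasing functions under a product measure\<close>

text \<open>
  Induction on the number of variables. Single out the variable \<open>t\<close> with index \<open>k\<close> and choose
  Borel increasing \<open>V\<^sub>t \<le> u(\<cdot>, t) \<le> W\<^sub>t\<close> for every slice. These cannot simply be glued
  together, since the choices for different \<open>t\<close> are unrelated. But if \<open>Q\<close> is countable, then
  \<open>v(x, t) = sup {V\<^sub>q x | q \<in> Q, q \<le> t}\<close> and \<open>w(x, t) = inf {W\<^sub>q x | q \<in> Q, t \<le> q}\<close> are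
  Borel and increasing, and they enclose \<open>u\<close>.

  It remains to choose \<open>Q\<close> so that \<open>v(\<cdot>, t) = w(\<cdot>, t)\<close> almost everywhere, for every \<open>t\<close>. The
  integral \<open>m(t)\<close> of \<open>arctan \<circ> V\<^sub>t\<close>, which is also that of \<open>arctan \<circ> W\<^sub>t\<close>, is increasing in
  \<open>t\<close>, so it has only countably many discontinuities. Let \<open>Q\<close> consist of these and of the
  rationals. If \<open>t \<in> Q\<close>, then \<open>V\<^sub>t \<le> v(\<cdot>, t) \<le> w(\<cdot>, t) \<le> W\<^sub>t\<close>, and the
  outer functions agree almost everywhere. If \<open>t \<notin> Q\<close>, then the
  integral of \<open>arctan \<circ> v(\<cdot>, t)\<close> is at least \<open>m(q)\<close> for all rational \<open>q < t\<close>, hence at least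
  \<open>m(t)\<close> by continuity, and that of \<open>arctan \<circ> w(\<cdot>, t)\<close> is at most \<open>m(t)\<close>. Fubini's theorem
  then gives \<open>v = w\<close> almost everywhere. The function \<open>arctan\<close> is there to make the slices
  integrable; any bounded strictly increasing function would do.
\<close>

lemma increasing_between_Borel:
  fixes N :: "'k \<Rightarrow> real measure" and u :: "('k \<Rightarrow> real) \<Rightarrow> real"
  assumes "finite J"
    and N: "\<And>k. prob_space (N k)" "\<And>k. sets (N k) = sets borel"
    and u: "coord_increasing J u"
  shows "\<exists>v w. coord_increasing J v \<and> coord_increasing J w \<and>
    v \<in> borel_measurable (PiM J (\<lambda>_. borel)) \<and> w \<in> borel_measurable (PiM J (\<lambda>_. borel)) \<and>
    (\<forall>x\<in>J \<rightarrow>\<^sub>E UNIV. v x \<le> u x \<and> u x \<le> w x) \<and>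
    (AE x in PiM J N. v x = w x)"
  using \<open>finite J\<close> u
proof (induction J arbitrary: u)
  case empty
  show ?case
    by (intro exI[of _ u] conjI empty.prems)
       (auto simp: PiM_empty)
next
  case (insert k J)
  interpret Nk: prob_space "N k" by (rule N(1))
  interpret J: prob_space "PiM J N" using N(1) by (intro prob_space_PiM) auto
  interpret product_sigma_finite N
    using N(1) by (simp add: product_sigma_finite_def prob_space_imp_sigma_finite)
  have setsN: "sets (PiM L N) = sets (PiM L (\<lambda>_. borel))" for L :: "'k set"
    by (rule sets_PiM_cong) (simp_all add: N(2))
  have measN: "borel_measurable (PiM L N) = borel_measurable (PiM L (\<lambda>_. borel :: real measure))" for L :: "'k set"
    by (rule measurable_cong_sets) (simp_all add: setsN)
  have spJ: "space (PiM L N) = L \<rightarrow>\<^sub>E UNIV" for L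
    using sets_eq_imp_space_eq[OF setsN, of L] by (simp add: space_PiM)
  have u_le: "u x \<le> u y" if "x \<in> insert k J \<rightarrow>\<^sub>E UNIV" "y \<in> insert k J \<rightarrow>\<^sub>E UNIV" "x \<le> y" for x y
    using insert.prems that unfolding coord_increasing_def mono_on_def by blast
  have upd: "x(k := t) \<in> insert k J \<rightarrow>\<^sub>E UNIV" if "x \<in> J \<rightarrow>\<^sub>E UNIV" for x and t :: real
    using that by (auto simp: PiE_iff extensional_def)
  have "coord_increasing J (\<lambda>x. u (x(k := t)))" for t
    unfolding coord_increasing_def
    by (intro mono_onI u_le upd) (auto simp: le_fun_def)
  from insert.IH[OF this]
  have ex: "\<exists>v w. coord_increasing J v \<and> coord_increasing J w \<and>
      v \<in> borel_measurable (PiM J (\<lambda>_. borel)) \<and> w \<in> borel_measurable (PiM J (\<lambda>_. borel)) \<and>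
      (\<forall>x\<in>J \<rightarrow>\<^sub>E UNIV. v x \<le> u (x(k := t)) \<and> u (x(k := t)) \<le> w x) \<and>
      (AE x in PiM J N. v x = w x)" (is "\<exists>v w. ?between t v w") for t .
  define V where "V t = (SOME v. \<exists>w. ?between t v w)" for t
  define W where "W t = (SOME w. ?between t (V t) w)" for t
  have "\<exists>w. ?between t (V t) w" for t
    unfolding V_def by (rule someI_ex[OF ex])
  then have VW_all: "?between t (V t) (W t)" for t
    unfolding W_def by (rule someI_ex)
  have V_inc: "coord_increasing J (V t)" and W_inc: "coord_increasing J (W t)"
    and V_meas: "V t \<in> borel_measurable (PiM J (\<lambda>_. borel))"
    and W_meas: "W t \<in> borel_measurable (PiM J (\<lambda>_. borel))"
    and VW: "AE x in PiM J N. V t x = W t x" for t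
    using VW_all[of t] by auto
  have V_le: "V t x \<le> u (x(k := t))" and W_ge: "u (x(k := t)) \<le> W t x"
    if "x \<in> J \<rightarrow>\<^sub>E UNIV" for t x
    using VW_all[of t] that by blast+
  have [measurable]: "V t \<in> borel_measurable (PiM J N)" "W t \<in> borel_measurable (PiM J N)" for t
    using V_meas W_meas by (auto simp: measN)
  have arctan_int: "integrable (PiM J N) (\<lambda>x. arctan (h x))" if "h \<in> borel_measurable (PiM J N)" for h
  proof -
    have "\<bar>arctan y\<bar> \<le> pi" for y
      using arctan_lbound[of y] arctan_ubound[of y] pi_gt_zero by linarith
    then show ?thesis
      using that by (intro J.integrable_const_bound[where B=pi] measurable_compose[OF that]) auto
  qed
  define m where "m t = (\<integral>x. arctan (V t x) \<partial>PiM J N)" for t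
  have m_W: "m t = (\<integral>x. arctan (W t x) \<partial>PiM J N)" for t
    unfolding m_def using VW[of t] by (intro integral_cong_AE) auto
  \<comment> \<open>Monotonicity in \<open>t\<close> comes from \<open>u\<close>, which separates \<open>V s\<close> from \<open>W t\<close>.\<close>
  have "m s \<le> m t" if "s \<le> t" for s t
  proof -
    have "m s \<le> (\<integral>x. arctan (W t x) \<partial>PiM J N)"
      unfolding m_def
    proof (intro integral_mono arctan_int)
      fix x assume "x \<in> space (PiM J N)"
      then have x: "x \<in> J \<rightarrow>\<^sub>E UNIV" by (simp add: spJ)
      have "V s x \<le> u (x(k := s))" by (rule V_le[OF x])
      also have "\<dots> \<le> u (x(k := t))" by (intro u_le upd x) (use that in \<open>auto simp: le_fun_def\<close>)
      also have "\<dots> \<le> W t x" by (rule W_ge[OF x])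
      finally show "arctan (V s x) \<le> arctan (W t x)" by (simp add: arctan_le_iff)
    qed auto
    then show ?thesis by (simp add: m_W)
  qed
  then have "mono m" by (rule monoI)
  define Q where "Q = \<rat> \<union> {t. \<not> isCont m t}"
  have Q: "countable Q" unfolding Q_def using mono_ctble_discont[OF \<open>mono m\<close>] by (auto intro: countable_rat)
  have Q_below: "\<exists>q\<in>Q. q \<le> t" for t
    by (rule bexI[of _ "of_int \<lfloor>t\<rfloor>"]) (auto simp: Q_def)
  have Q_above: "\<exists>q\<in>Q. t \<le> q" for t
    by (rule bexI[of _ "of_int \<lceil>t\<rceil>"]) (auto simp: Q_def)
  have res: "restrict x J \<in> J \<rightarrow>\<^sub>E UNIV" for x :: "'k \<Rightarrow> real" by auto
  have res_upd: "(restrict x J)(k := x k) = x" if "x \<in> insert k J \<rightarrow>\<^sub>E UNIV" for x :: "'k \<Rightarrow> real"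
    using that by (auto simp: PiE_iff extensional_def fun_eq_iff)
  have upd_res: "restrict (x(k := t)) J = x" if "x \<in> J \<rightarrow>\<^sub>E UNIV" for x and t :: real
    using that insert.hyps by (auto simp: PiE_iff extensional_def fun_eq_iff)
  have res_mono: "restrict x J \<le> restrict y J" if "x \<le> y" for x y :: "'k \<Rightarrow> real"
    using that by (auto simp: le_fun_def)
  define v where "v x = (SUP q\<in>{q\<in>Q. q \<le> x k}. V q (restrict x J))" for x
  define w where "w x = (INF q\<in>{q\<in>Q. x k \<le> q}. W q (restrict x J))" for x
  \<comment> \<open>The value of \<open>u\<close> itself bounds the supremum and the infimum, so both are real.\<close>
  have Vu: "V q (restrict x J) \<le> u x" if "x \<in> insert k J \<rightarrow>\<^sub>E UNIV" "q \<le> x k" for q x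
  proof -
    have "V q (restrict x J) \<le> u ((restrict x J)(k := q))" by (rule V_le[OF res])
    also have "\<dots> \<le> u ((restrict x J)(k := x k))"
      by (intro u_le upd res) (use that in \<open>auto simp: le_fun_def\<close>)
    finally show ?thesis by (simp only: res_upd[OF that(1)])
  qed
  have uW: "u x \<le> W q (restrict x J)" if "x \<in> insert k J \<rightarrow>\<^sub>E UNIV" "x k \<le> q" for q x
  proof -
    have "u ((restrict x J)(k := x k)) \<le> u ((restrict x J)(k := q))"
      by (intro u_le upd res) (use that in \<open>auto simp: le_fun_def\<close>)
    also have "\<dots> \<le> W q (restrict x J)" by (rule W_ge[OF res])
    finally show ?thesis by (simp only: res_upd[OF that(1)])
  qed
  have bddV: "bdd_above ((\<lambda>q. V q (restrict x J)) ` {q\<in>Q. q \<le> x k})" if "x \<in> insert k J \<rightarrow>\<^sub>E UNIV" for x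
    using Vu[OF that] by (auto intro!: bdd_aboveI[where M="u x"])
  have bddW: "bdd_below ((\<lambda>q. W q (restrict x J)) ` {q\<in>Q. x k \<le> q})" if "x \<in> insert k J \<rightarrow>\<^sub>E UNIV" for x
    using uW[OF that] by (auto intro!: bdd_belowI[where m="u x"])
  have neV: "{q\<in>Q. q \<le> t} \<noteq> {}" and neW: "{q\<in>Q. t \<le> q} \<noteq> {}" for t
    using Q_below[of t] Q_above[of t] by auto
  have vu: "v x \<le> u x" if "x \<in> insert k J \<rightarrow>\<^sub>E UNIV" for x
    unfolding v_def using Vu[OF that] neV by (intro cSUP_least) auto
  have uw: "u x \<le> w x" if "x \<in> insert k J \<rightarrow>\<^sub>E UNIV" for x
    unfolding w_def using uW[OF that] neW by (intro cINF_greatest) auto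
  have Vv: "V q (restrict x J) \<le> v x" if "x \<in> insert k J \<rightarrow>\<^sub>E UNIV" "q \<in> Q" "q \<le> x k" for q x
    unfolding v_def using that bddV by (intro cSUP_upper) auto
  have wW: "w x \<le> W q (restrict x J)" if "x \<in> insert k J \<rightarrow>\<^sub>E UNIV" "q \<in> Q" "x k \<le> q" for q x
    unfolding w_def using that bddW by (intro cINF_lower) auto
  have v_inc: "coord_increasing (insert k J) v"
    unfolding coord_increasing_def
  proof (rule mono_onI)
    fix x y :: "'k \<Rightarrow> real"
    assume x: "x \<in> insert k J \<rightarrow>\<^sub>E UNIV" and y: "y \<in> insert k J \<rightarrow>\<^sub>E UNIV" and le: "x \<le> y"
    have k: "x k \<le> y k" using le by (simp add: le_fun_def)
    show "v x \<le> v y"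
      unfolding v_def[of x]
    proof (rule cSUP_least[OF neV])
      fix q assume q: "q \<in> {q \<in> Q. q \<le> x k}"
      have "V q (restrict x J) \<le> V q (restrict y J)"
        using V_inc[of q] res res_mono[OF le] unfolding coord_increasing_def mono_on_def by blast
      also have "\<dots> \<le> v y" using q k by (intro Vv[OF y]) auto
      finally show "V q (restrict x J) \<le> v y" .
    qed
  qed
  have w_inc: "coord_increasing (insert k J) w"
    unfolding coord_increasing_def
  proof (rule mono_onI)
    fix x y :: "'k \<Rightarrow> real"
    assume x: "x \<in> insert k J \<rightarrow>\<^sub>E UNIV" and y: "y \<in> insert k J \<rightarrow>\<^sub>E UNIV" and le: "x \<le> y"
    have k: "x k \<le> y k" using le by (simp add: le_fun_def)
    show "w x \<le> w y"
      unfolding w_def[of y]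
    proof (rule cINF_greatest[OF neW])
      fix q assume q: "q \<in> {q \<in> Q. y k \<le> q}"
      have "w x \<le> W q (restrict x J)" using q k by (intro wW[OF x]) auto
      also have "\<dots> \<le> W q (restrict y J)"
        using W_inc[of q] res res_mono[OF le] unfolding coord_increasing_def mono_on_def by blast
      finally show "w x \<le> W q (restrict y J)" .
    qed
  qed
  have resm [measurable]: "(\<lambda>x. restrict x J) \<in> measurable (PiM (insert k J) N) (PiM J N)"
    by (rule measurable_restrict_subset) auto
  have km [measurable]: "(\<lambda>x. x k) \<in> borel_measurable (PiM (insert k J) N)"
    using measurable_component_singleton[of k "insert k J" N]
    by (simp only: measurable_cong_sets[OF refl N(2)] insertI1)
  have v_meas: "v \<in> borel_measurable (PiM (insert k J) N)"
    unfolding borel_measurable_iff_greater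
  proof
    fix a
    have "{x \<in> space (PiM (insert k J) N). a < v x}
      = (\<Union>q\<in>Q. {x \<in> space (PiM (insert k J) N). q \<le> x k \<and> a < V q (restrict x J)})"
      unfolding spJ v_def using less_cSUP_iff[OF neV bddV] by auto
    also have "\<dots> \<in> sets (PiM (insert k J) N)"
      by (rule sets.countable_UN'[OF Q]) (intro image_subsetI; measurable)
    finally show "{x \<in> space (PiM (insert k J) N). a < v x} \<in> sets (PiM (insert k J) N)" .
  qed
  have w_meas: "w \<in> borel_measurable (PiM (insert k J) N)"
    unfolding borel_measurable_iff_less
  proof
    fix a
    have "{x \<in> space (PiM (insert k J) N). w x < a}
      = (\<Union>q\<in>Q. {x \<in> space (PiM (insert k J) N). x k \<le> q \<and> W q (restrict x J) < a})"
      unfolding spJ w_def using cINF_less_iff[OF neW bddW] by auto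
    also have "\<dots> \<in> sets (PiM (insert k J) N)"
      by (rule sets.countable_UN'[OF Q]) (intro image_subsetI; measurable)
    finally show "{x \<in> space (PiM (insert k J) N). w x < a} \<in> sets (PiM (insert k J) N)" .
  qed
  note [measurable] = v_meas w_meas
  have slice: "AE x in PiM J N. v (x(k := t)) = w (x(k := t))" for t
  proof (cases "t \<in> Q")
    case True
    have "v (x(k := t)) = w (x(k := t))" if x: "x \<in> J \<rightarrow>\<^sub>E UNIV" and eq: "V t x = W t x" for x
    proof (rule antisym)
      show "v (x(k := t)) \<le> w (x(k := t))" 
        by (rule order_trans[OF vu[OF upd[OF x]] uw[OF upd[OF x]]])
      have "w (x(k := t)) \<le> W t x" using wW[OF upd[OF x] True] by (simp add: upd_res[OF x])
      also have "\<dots> \<le> v (x(k := t))" using Vv[OF upd[OF x] True] eq by (simp add: upd_res[OF x])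
      finally show "w (x(k := t)) \<le> v (x(k := t))" .
    qed
    then show ?thesis
      using VW[of t] by (elim AE_mp) (intro AE_I2 impI, simp only: spJ)
  next
    case False
    then have cont: "isCont m t" by (simp add: Q_def)
    have "t \<in> space (N k)" using sets_eq_imp_space_eq[OF N(2)] by simp
    then have [measurable]: "(\<lambda>x. x(k := t)) \<in> measurable (PiM J N) (PiM (insert k J) N)"
      by (intro measurable_fun_upd[where J=J]) auto
    have v_int: "integrable (PiM J N) (\<lambda>x. arctan (v (x(k := t))))"
      and w_int: "integrable (PiM J N) (\<lambda>x. arctan (w (x(k := t))))"
      by (intro arctan_int; measurable)+
    have le: "arctan (v (x(k := t))) \<le> arctan (w (x(k := t)))" if "x \<in> space (PiM J N)" for x
      using vu[OF upd, of x t] uw[OF upd, of x t] that by (simp add: spJ arctan_le_iff)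
    have "m s \<le> (\<integral>x. arctan (v (x(k := t))) \<partial>PiM J N)" if st: "s < t" for s
    proof -
      obtain q where q: "q \<in> \<rat>" "s < q" "q < t" using Rats_dense_in_real[OF st] by blast
      have "m s \<le> m q" using \<open>mono m\<close> q by (simp add: monoD)
      also have "\<dots> \<le> (\<integral>x. arctan (v (x(k := t))) \<partial>PiM J N)"
        unfolding m_def
      proof (intro integral_mono v_int arctan_int)
        fix x assume "x \<in> space (PiM J N)"
        then show "arctan (V q x) \<le> arctan (v (x(k := t)))"
          using Vv[OF upd, of x q t] q by (simp add: spJ arctan_le_iff upd_res Q_def)
      qed auto
      finally show ?thesis .
    qed
    then have lo: "m t \<le> (\<integral>x. arctan (v (x(k := t))) \<partial>PiM J N)"
      using cont by (intro tendsto_upperbound[where F="at_left t" and f=m])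
        (auto simp: isCont_def eventually_at_filter filterlim_at_split intro!: always_eventually)
    have "(\<integral>x. arctan (w (x(k := t))) \<partial>PiM J N) \<le> m s" if st: "t < s" for s
    proof -
      obtain q where q: "q \<in> \<rat>" "t < q" "q < s" using Rats_dense_in_real[OF st] by blast
      have "(\<integral>x. arctan (w (x(k := t))) \<partial>PiM J N) \<le> m q"
        unfolding m_W
      proof (intro integral_mono w_int arctan_int)
        fix x assume "x \<in> space (PiM J N)"
        then show "arctan (w (x(k := t))) \<le> arctan (W q x)"
          using wW[OF upd, of x q t] q by (simp add: spJ arctan_le_iff upd_res Q_def)
      qed auto
      also have "\<dots> \<le> m s" using \<open>mono m\<close> q by (simp add: monoD)
      finally show ?thesis .
    qed
    then have hi: "(\<integral>x. arctan (w (x(k := t))) \<partial>PiM J N) \<le> m t"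
      using cont by (intro tendsto_lowerbound[where F="at_right t" and f=m])
        (auto simp: isCont_def eventually_at_filter filterlim_at_split intro!: always_eventually)
    have "(\<integral>x. arctan (v (x(k := t))) \<partial>PiM J N) = (\<integral>x. arctan (w (x(k := t))) \<partial>PiM J N)"
      using lo hi integral_mono[OF v_int w_int le] by linarith
    then have "(\<integral>x. arctan (w (x(k := t))) - arctan (v (x(k := t))) \<partial>PiM J N) = 0"
      using v_int w_int by simp
    then have "AE x in PiM J N. arctan (w (x(k := t))) - arctan (v (x(k := t))) = 0"
      using v_int w_int le by (subst (asm) integral_nonneg_eq_0_iff_AE) auto
    then show ?thesis by eventually_elim (simp add: arctan_eq_iff)
  qed
  have vw: "AE x in PiM (insert k J) N. v x = w x"
  proof -
    let ?E = "{x \<in> space (PiM (insert k J) N). v x \<noteq> w x}"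
    have [measurable]: "?E \<in> sets (PiM (insert k J) N)"
      by (rule borel_measurable_neq[OF v_meas w_meas])
    have "emeasure (PiM (insert k J) N) ?E = (\<integral>\<^sup>+x. indicator ?E x \<partial>PiM (insert k J) N)"
      by simp
    also have "\<dots> = (\<integral>\<^sup>+t. (\<integral>\<^sup>+x. indicator ?E (x(k := t)) \<partial>PiM J N) \<partial>N k)"
      using insert.hyps by (intro product_nn_integral_insert_rev) auto
    also have "\<dots> = (\<integral>\<^sup>+t. (\<integral>\<^sup>+x. 0 \<partial>PiM J N) \<partial>N k)"
    proof (rule nn_integral_cong, rule nn_integral_cong_AE)
      fix t
      show "AE x in PiM J N. indicator ?E (x(k := t)) = (0 :: ennreal)"
        using slice[of t] by eventually_elim simp
    qed
    finally show ?thesis by (intro AE_I[where N="?E"]) auto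
  qed
  show ?case
    by (intro exI[of _ v] exI[of _ w] conjI ballI v_inc w_inc
        v_meas[unfolded measN] w_meas[unfolded measN] vu uw vw)
qed

section \<open>Increasing functions of independent negatively associated vectors\<close>

text \<open>
  For an empty index set both sides are the unit mass at the only point of the empty product, so
  a number of vectors equal to zero calls for no separate treatment later.
\<close>

lemma (in prob_space) indep_vars_distr_PiM:
  assumes ind: "indep_vars M' X J"
  shows "distr M (PiM J M') (\<lambda>\<omega>. \<lambda>k\<in>J. X k \<omega>) = PiM J (\<lambda>k. distr M (M' k) (X k))"
proof (cases "J = {}")
  case True
  show ?thesis
    unfolding True
  proof (rule measure_eqI)
    fix A assume "A \<in> sets (distr M (PiM {} M') (\<lambda>\<omega>. \<lambda>k\<in>{}. X k \<omega>))"
    then have "A = {} \<or> A = {\<lambda>_. undefined}" by (simp add: sets_PiM_empty)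
    moreover have "(\<lambda>\<omega>. \<lambda>k\<in>{}. X k \<omega>) = (\<lambda>_ _. undefined)" by (auto simp: fun_eq_iff)
    ultimately show "emeasure (distr M (PiM {} M') (\<lambda>\<omega>. \<lambda>k\<in>{}. X k \<omega>)) A
      = emeasure (PiM {} (\<lambda>k. distr M (M' k) (X k))) A"
      by (auto simp: emeasure_distr sets_PiM_empty emeasure_space_1)
  qed (simp add: sets_PiM_empty)
next
  case False
  with ind show ?thesis
    by (subst indep_vars_iff_distr_eq_PiM'[symmetric]) (auto simp: indep_vars_def)
qed

text \<open>
  The truncated test functions of the \<open>S\<^sub>i\<close> are pulled back to the functions \<open>F\<close> of the array
  of all vectors, whose law is the product of the laws of the vectors.
\<close>

lemma (in prob_space) neg_assoc_increasing_Borel: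
  fixes X :: "'k \<Rightarrow> 'i \<Rightarrow> 'a \<Rightarrow> real"
  assumes "finite J"
    and ind: "indep_vars (\<lambda>k. PiM I (\<lambda>_. borel)) (\<lambda>k \<omega>. \<lambda>i\<in>I. X k i \<omega>) J"
    and na: "\<And>k. k \<in> J \<Longrightarrow> neg_assoc M I (X k)"
    and u: "\<And>i. i \<in> I \<Longrightarrow> coord_increasing J (u i)"
    and u_meas: "\<And>i. i \<in> I \<Longrightarrow> u i \<in> borel_measurable (PiM J (\<lambda>_. borel))"
  shows "neg_assoc M I (\<lambda>i \<omega>. u i (\<lambda>k\<in>J. X k i \<omega>))"
proof -
  let ?V = "\<lambda>\<omega>. \<lambda>k\<in>J. \<lambda>i\<in>I. X k i \<omega>"
  \<comment> \<open>Outside \<open>J\<close> a point mass makes every \<open>N k\<close> a probability measure.\<close>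
  define N where "N k = (if k \<in> J then distr M (PiM I (\<lambda>_. borel)) (\<lambda>\<omega>. \<lambda>i\<in>I. X k i \<omega>)
    else return (PiM I (\<lambda>_. borel)) (\<lambda>i\<in>I. 0))" for k
  have X: "X k i \<in> borel_measurable M" if "k \<in> J" "i \<in> I" for k i
    using na[OF that(1)] that(2) by (simp add: neg_assoc_def)
  have vec: "(\<lambda>\<omega>. \<lambda>i\<in>I. X k i \<omega>) \<in> measurable M (PiM I (\<lambda>_. borel))" if "k \<in> J" for k
    by (rule measurable_restrict) (rule X[OF that])
  have V: "?V \<in> measurable M (PiM J (\<lambda>_. PiM I (\<lambda>_. borel)))"
    by (rule measurable_restrict) (rule vec)
  have N_prob: "prob_space (N k)" for k
    by (cases "k \<in> J") (auto simp: N_def space_PiM intro!: prob_space_distr vec prob_space_return)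
  have N_sets: "sets (N k) = sets (PiM I (\<lambda>_. borel))" for k
    by (simp add: N_def)
  have N_na: "neg_assoc_law I (N k)" if "k \<in> J" for k
    using neg_assoc_imp_law[OF na[OF that]] that by (simp add: N_def)
  have law: "PiM J N = distr M (PiM J (\<lambda>_. PiM I (\<lambda>_. borel))) ?V"
    unfolding indep_vars_distr_PiM[OF ind] by (rule PiM_cong) (simp_all add: N_def)
  have Sm: "(\<lambda>x. u i (\<lambda>k\<in>J. x k i)) \<in> borel_measurable (PiM J (\<lambda>_. PiM I (\<lambda>_. borel)))"
    if "i \<in> I" for i
  proof (rule measurable_compose[OF measurable_restrict u_meas[OF that]])
    show "(\<lambda>x. x k i) \<in> borel_measurable (PiM J (\<lambda>_. PiM I (\<lambda>_. borel)))" if "k \<in> J" for k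
      by (rule measurable_compose[OF measurable_component_singleton[OF \<open>k \<in> J\<close>]
            measurable_component_singleton[OF \<open>i \<in> I\<close>]])
  qed
  have comp: "(\<lambda>k\<in>J. ?V \<omega> k i) = (\<lambda>k\<in>J. X k i \<omega>)" if "i \<in> I" for i \<omega>
    using that by (intro restrict_ext) simp
  define F where "F m A f x = trunc m (f (\<lambda>i\<in>A. u i (\<lambda>k\<in>J. x k i)))"
    for m A and f :: "('i \<Rightarrow> real) \<Rightarrow> real" and x :: "'k \<Rightarrow> 'i \<Rightarrow> real"
  have F_V: "F m A f (?V \<omega>) = trunc m (f (\<lambda>i\<in>A. u i (\<lambda>k\<in>J. X k i \<omega>)))" if "A \<subseteq> I" for m A f \<omega>
    unfolding F_def using that
    by (intro arg_cong[where f="trunc m"] arg_cong[where f=f] restrict_ext arg_cong[where f="u _"] comp) auto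
  have F_meas: "F m A f \<in> borel_measurable (PiM J (\<lambda>_. PiM I (\<lambda>_. borel)))"
    if "A \<subseteq> I" "f \<in> borel_measurable (PiM A (\<lambda>_. borel))" for m A f
    unfolding F_def
    by (rule measurable_compose[OF measurable_compose[OF measurable_restrict that(2)] measurable_trunc])
      (use Sm that(1) in auto)
  have F_inc: "jointly_increasing J I A (F m A f)"
    if "A \<subseteq> I" "coord_increasing A f" for m A f
    unfolding jointly_increasing_def
  proof (intro ballI impI)
    fix x y :: "'k \<Rightarrow> 'i \<Rightarrow> real" assume le: "\<forall>k\<in>J. \<forall>i\<in>A. x k i \<le> y k i"
    have "u i (\<lambda>k\<in>J. x k i) \<le> u i (\<lambda>k\<in>J. y k i)" if "i \<in> A" for i
      using u[of i] that \<open>A \<subseteq> I\<close> le unfolding coord_increasing_def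
      by (intro mono_onD[where f="u i"]) (auto simp: le_fun_def)
    then have "f (\<lambda>i\<in>A. u i (\<lambda>k\<in>J. x k i)) \<le> f (\<lambda>i\<in>A. u i (\<lambda>k\<in>J. y k i))"
      using that(2) unfolding coord_increasing_def
      by (intro mono_onD[where f=f]) (auto simp: le_fun_def)
    then show "F m A f x \<le> F m A f y" unfolding F_def by (rule trunc_mono)
  qed
  have PN: "borel_measurable (PiM J N) = borel_measurable (PiM J (\<lambda>_. PiM I (\<lambda>_. borel :: real measure)))"
    by (intro measurable_cong_sets sets_PiM_cong) (simp_all add: N_sets)
  show ?thesis
    unfolding neg_assoc_def
  proof (intro conjI ballI allI impI; (elim conjE)?)
    fix i assume i: "i \<in> I"
    show "(\<lambda>\<omega>. u i (\<lambda>k\<in>J. X k i \<omega>)) \<in> borel_measurable M"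
      using measurable_compose[OF V Sm[OF i]] by (simp only: comp[OF i])
  next
    fix A1 A2 and f1 f2 :: "('i \<Rightarrow> real) \<Rightarrow> real"
    assume A: "A1 \<subseteq> I" "A2 \<subseteq> I" "A1 \<inter> A2 = {}"
      and f1: "coord_increasing A1 f1" "f1 \<in> borel_measurable (PiM A1 (\<lambda>_. borel))"
      and f2: "coord_increasing A2 f2" "f2 \<in> borel_measurable (PiM A2 (\<lambda>_. borel))"
      and hc: "has_covariance M (\<lambda>\<omega>. f1 (\<lambda>i\<in>A1. u i (\<lambda>k\<in>J. X k i \<omega>)))
        (\<lambda>\<omega>. f2 (\<lambda>j\<in>A2. u j (\<lambda>k\<in>J. X k j \<omega>)))"
    show "covariance M (\<lambda>\<omega>. f1 (\<lambda>i\<in>A1. u i (\<lambda>k\<in>J. X k i \<omega>)))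
        (\<lambda>\<omega>. f2 (\<lambda>j\<in>A2. u j (\<lambda>k\<in>J. X k j \<omega>))) \<le> 0"
    proof (rule covariance_nonpos_truncation[OF hc])
      fix m
      have F_bd: "\<bar>F m A f x\<bar> \<le> real m" for A f x
        unfolding F_def by (rule abs_trunc_le)
      have "(\<integral>x. F m A1 f1 x * F m A2 f2 x \<partial>PiM J N)
          \<le> (\<integral>x. F m A1 f1 x \<partial>PiM J N) * (\<integral>x. F m A2 f2 x \<partial>PiM J N)"
        by (rule neg_assoc_PiM[OF \<open>finite J\<close> N_prob N_sets N_na A F_inc[OF A(1) f1(1)] _ F_bd
              F_inc[OF A(2) f2(1)] _ F_bd])
          (simp_all only: PN F_meas[OF A(1) f1(2)] F_meas[OF A(2) f2(2)])
      then show "expectation (\<lambda>\<omega>. trunc m (f1 (\<lambda>i\<in>A1. u i (\<lambda>k\<in>J. X k i \<omega>))) *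
            trunc m (f2 (\<lambda>j\<in>A2. u j (\<lambda>k\<in>J. X k j \<omega>))))
          \<le> expectation (\<lambda>\<omega>. trunc m (f1 (\<lambda>i\<in>A1. u i (\<lambda>k\<in>J. X k i \<omega>)))) *
            expectation (\<lambda>\<omega>. trunc m (f2 (\<lambda>j\<in>A2. u j (\<lambda>k\<in>J. X k j \<omega>))))"
        unfolding law using F_meas[OF A(1) f1(2)] F_meas[OF A(2) f2(2)]
        by (simp add: integral_distr[OF V] F_V[OF A(1)] F_V[OF A(2)])
    qed
  qed
qed

text \<open>
  For fixed \<open>i\<close> the entries \<open>X k i\<close> with \<open>k \<in> J\<close> are independent, being functions of independent
  vectors, so their joint law is a product measure on \<open>\<real>\<^sup>J\<close> and the enclosure of \<open>u i\<close> by Borel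
  increasing functions is available.
\<close>

lemma (in prob_space) neg_assoc_increasing:
  fixes X :: "'k \<Rightarrow> 'i \<Rightarrow> 'a \<Rightarrow> real"
  assumes "finite I" "finite J"
    and ind: "indep_vars (\<lambda>k. PiM I (\<lambda>_. borel)) (\<lambda>k \<omega>. \<lambda>i\<in>I. X k i \<omega>) J"
    and na: "\<And>k. k \<in> J \<Longrightarrow> neg_assoc M I (X k)"
    and u: "\<And>i. i \<in> I \<Longrightarrow> coord_increasing J (u i)"
    and u_meas: "\<And>i. i \<in> I \<Longrightarrow> (\<lambda>\<omega>. u i (\<lambda>k\<in>J. X k i \<omega>)) \<in> borel_measurable M"
  shows "neg_assoc M I (\<lambda>i \<omega>. u i (\<lambda>k\<in>J. X k i \<omega>))"
proof -
  have "\<forall>i\<in>I. \<exists>v. coord_increasing J v \<and> v \<in> borel_measurable (PiM J (\<lambda>_. borel)) \<and>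
      (AE \<omega> in M. u i (\<lambda>k\<in>J. X k i \<omega>) = v (\<lambda>k\<in>J. X k i \<omega>))"
  proof
    fix i assume i: "i \<in> I"
    have X: "X k i \<in> borel_measurable M" if "k \<in> J" for k
      using na[OF that] i by (simp add: neg_assoc_def)
    then have Xi: "(\<lambda>\<omega>. \<lambda>k\<in>J. X k i \<omega>) \<in> measurable M (PiM J (\<lambda>_. borel))"
      by (rule measurable_restrict)
    define N where "N k = (if k \<in> J then distr M borel (X k i) else return borel 0)" for k
    have N: "prob_space (N k)" "sets (N k) = sets borel" for k
      by (auto simp: N_def intro!: prob_space_distr X prob_space_return)
    have "indep_vars (\<lambda>_. borel) (\<lambda>k \<omega>. (\<lambda>i\<in>I. X k i \<omega>) i) J"
      using i by (intro indep_vars_compose2[OF ind]) auto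
    then have "indep_vars (\<lambda>_. borel) (\<lambda>k. X k i) J" using i by simp
    from indep_vars_distr_PiM[OF this]
    have law: "distr M (PiM J (\<lambda>_. borel)) (\<lambda>\<omega>. \<lambda>k\<in>J. X k i \<omega>) = PiM J N"
      by (simp add: N_def cong: PiM_cong)
    obtain v w where v: "coord_increasing J v" "v \<in> borel_measurable (PiM J (\<lambda>_. borel))"
      and w: "w \<in> borel_measurable (PiM J (\<lambda>_. borel))"
      and le: "\<forall>x\<in>J \<rightarrow>\<^sub>E UNIV. v x \<le> u i x \<and> u i x \<le> w x"
      and ae: "AE x in PiM J N. v x = w x"
      using increasing_between_Borel[of J N, OF \<open>finite J\<close> N u[OF i]] by blast
    have "{x \<in> space (PiM J (\<lambda>_. borel)). v x = w x} \<in> sets (PiM J (\<lambda>_. borel))"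
      using v(2) w by measurable
    with ae have "AE \<omega> in M. v (\<lambda>k\<in>J. X k i \<omega>) = w (\<lambda>k\<in>J. X k i \<omega>)"
      unfolding law[symmetric] by (subst (asm) AE_distr_iff[OF Xi])
    then have "AE \<omega> in M. u i (\<lambda>k\<in>J. X k i \<omega>) = v (\<lambda>k\<in>J. X k i \<omega>)"
    proof eventually_elim
      case (elim \<omega>)
      have "(\<lambda>k\<in>J. X k i \<omega>) \<in> J \<rightarrow>\<^sub>E UNIV" by simp
      then show ?case using le elim by (metis order_antisym)
    qed
    with v show "\<exists>v. coord_increasing J v \<and> v \<in> borel_measurable (PiM J (\<lambda>_. borel)) \<and>
      (AE \<omega> in M. u i (\<lambda>k\<in>J. X k i \<omega>) = v (\<lambda>k\<in>J. X k i \<omega>))" by blast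
  qed
  from bchoice[OF this] obtain v where "\<forall>i\<in>I. coord_increasing J (v i) \<and>
      v i \<in> borel_measurable (PiM J (\<lambda>_. borel)) \<and>
      (AE \<omega> in M. u i (\<lambda>k\<in>J. X k i \<omega>) = v i (\<lambda>k\<in>J. X k i \<omega>))" by (rule exE)
  then have v: "coord_increasing J (v i)" "v i \<in> borel_measurable (PiM J (\<lambda>_. borel))"
    "AE \<omega> in M. u i (\<lambda>k\<in>J. X k i \<omega>) = v i (\<lambda>k\<in>J. X k i \<omega>)" if "i \<in> I" for i
    using that by simp_all
  show ?thesis
    by (rule neg_assoc_cong_AE[OF \<open>finite I\<close>
          neg_assoc_increasing_Borel[OF \<open>finite J\<close> ind na v(1,2)] u_meas v(3)])
qed

theorem theorem2p2:
  fixes M :: "'a measure" and n K :: nat and X :: "nat \<Rightarrow> nat \<Rightarrow> 'a \<Rightarrow> real"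
  assumes "prob_space M"
    and "prob_space.indep_vars M (\<lambda>k. PiM {1..n} (\<lambda>_. borel))
           (\<lambda>k \<omega>. \<lambda>i\<in>{1..n}. X k i \<omega>) {1..K}"
    and "\<forall>k\<in>{1..K}. neg_assoc M {1..n} (X k)"
  shows "neg_assoc M {1..n} (\<lambda>i \<omega>. \<Sum>k=1..K. X k i \<omega>) \<and>
    (\<forall>u :: nat \<Rightarrow> (nat \<Rightarrow> real) \<Rightarrow> real.
       (\<forall>i\<in>{1..n}. coord_increasing {1..K} (u i)) \<and>
       (\<forall>i\<in>{1..n}. (\<lambda>\<omega>. u i (\<lambda>k\<in>{1..K}. X k i \<omega>)) \<in> borel_measurable M) \<longrightarrow>
       neg_assoc M {1..n} (\<lambda>i \<omega>. u i (\<lambda>k\<in>{1..K}. X k i \<omega>)))"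
proof (intro conjI allI impI)
  interpret prob_space M by fact
  note na = bspec[OF assms(3)]
  have "neg_assoc M {1..n} (\<lambda>i \<omega>. (\<lambda>y. \<Sum>k=1..K. y k) (\<lambda>k\<in>{1..K}. X k i \<omega>))"
    by (rule neg_assoc_increasing_Borel[OF finite_atLeastAtMost assms(2) na])
      (auto simp: coord_increasing_def le_fun_def intro!: mono_onI sum_mono)
  then show "neg_assoc M {1..n} (\<lambda>i \<omega>. \<Sum>k=1..K. X k i \<omega>)" by simp
  fix u :: "nat \<Rightarrow> (nat \<Rightarrow> real) \<Rightarrow> real"
  assume "(\<forall>i\<in>{1..n}. coord_increasing {1..K} (u i)) \<and>
       (\<forall>i\<in>{1..n}. (\<lambda>\<omega>. u i (\<lambda>k\<in>{1..K}. X k i \<omega>)) \<in> borel_measurable M)"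
  then show "neg_assoc M {1..n} (\<lambda>i \<omega>. u i (\<lambda>k\<in>{1..K}. X k i \<omega>))"
    by (intro neg_assoc_increasing[OF finite_atLeastAtMost finite_atLeastAtMost assms(2) na]) blast+
qed

end
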